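(* Let $S$ be a binary coherent system with $n$ components that is strongly stable with respect to the usual ordering $1<2<\cdots<n$ of the components, and let $\mathbf{p}=(p_1,\dots,p_n)\in[0,1]^n$. For a permutation $\sigma$ of the entries of $\mathbf{p}$ let $\sigma(\mathbf{p})$ denote the permuted vector. Then the maximum of $R_{\sigma(\mathbf{p})}(S)$ over all permutations $\sigma$ is attained when $\sigma$ is a monotone descending ordering of the elements of $\mathbf{p}$, i.e. when the entries of $\sigma(\mathbf{p})$ are in non-increasing order.
   Context: A binary system has components $c_1,\dots,c_n$ each with states $\{0,1\}$ (failed/working) and structure function $\Phi:\{0,1\}^n\to\{0,1\}$. It is coherent if $\Phi$ is non-decreasing for the componentwise order and each component is relevant (its state does affect the system state). A path (working state) is a tuple $s\in\{0,1\}^n$ with $\Phi(s)=1$. The binary system is strongly stable with respect to the ordering $1<2<\cdots<n$ if for every path $m=(m_1,\dots,m_n)$ and all $j<i$ with $m_i=1$ and $m_j=0$, the tuple obtained from $m$ by replacing $m_i$ by $0$ and $m_j$ by $1$ is also a path. For $\mathbf{q}=(q_1,\dots,q_n)$, the components are assumed to work independently, with $q_k$ the probability that component $c_k$ works, and $R_{\mathbf{q}}(S)$ is the probability that the random state $(c_1,\dots,c_n)$ satisfies $\Phi(c_1,\dots,c_n)=1$. *)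

theory Defs
  imports "HOL-Probability.Product_PMF" "HOL-Combinatorics.Permutations"
begin

text \<open>
  A binary system with components \<open>1, \<dots>, n\<close> is given by \<open>n\<close> and its structure function \<open>\<Phi>\<close>.
  The states 0 (failed) and 1 (working) are \<^const>\<open>False\<close> and \<^const>\<open>True\<close>.
  A tuple in \<open>{0,1}\<^sup>n\<close> is a function with the fixed value \<^const>\<open>False\<close> outside \<open>{1..n}\<close>, so that
  the pointwise order of functions is the componentwise order of tuples; the values of \<open>\<Phi>\<close>
  on other functions play no role.
\<close>

definition states :: "nat \<Rightarrow> (nat \<Rightarrow> bool) set" where
  "states n = PiE_dflt {1..n} False (\<lambda>_. UNIV)"

definition is_path :: "nat \<Rightarrow> ((nat \<Rightarrow> bool) \<Rightarrow> bool) \<Rightarrow> (nat \<Rightarrow> bool) \<Rightarrow> bool" where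
  "is_path n \<Phi> s \<longleftrightarrow> s \<in> states n \<and> \<Phi> s"

definition relevant :: "nat \<Rightarrow> ((nat \<Rightarrow> bool) \<Rightarrow> bool) \<Rightarrow> nat \<Rightarrow> bool" where
  "relevant n \<Phi> i \<longleftrightarrow> (\<exists>s\<in>states n. \<Phi> (s(i := True)) \<noteq> \<Phi> (s(i := False)))"

definition coherent_system :: "nat \<Rightarrow> ((nat \<Rightarrow> bool) \<Rightarrow> bool) \<Rightarrow> bool" where
  "coherent_system n \<Phi> \<longleftrightarrow> mono_on (states n) \<Phi> \<and> (\<forall>i\<in>{1..n}. relevant n \<Phi> i)"

definition strongly_stable :: "nat \<Rightarrow> ((nat \<Rightarrow> bool) \<Rightarrow> bool) \<Rightarrow> bool" where
  "strongly_stable n \<Phi> \<longleftrightarrow>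
     (\<forall>m. is_path n \<Phi> m \<longrightarrow>
       (\<forall>i\<in>{1..n}. \<forall>j\<in>{1..n}. j < i \<longrightarrow> m i \<longrightarrow> \<not> m j \<longrightarrow>
          is_path n \<Phi> (m(i := False, j := True))))"

text \<open>
  \<^const>\<open>Pi_pmf\<close> is the joint distribution of independent components; component \<open>k\<close> works with
  probability \<open>q k\<close> provided that \<open>q k \<in> {0..1}\<close>. Values of \<open>q\<close> outside \<open>{1..n}\<close> are irrelevant.
\<close>

definition reliability :: "nat \<Rightarrow> ((nat \<Rightarrow> bool) \<Rightarrow> bool) \<Rightarrow> (nat \<Rightarrow> real) \<Rightarrow> real" where
  "reliability n \<Phi> q =
     measure_pmf.prob (Pi_pmf {1..n} False (\<lambda>k. bernoulli_pmf (q k))) {s. is_path n \<Phi> s}"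

end

theory Submission
  imports Defs
begin

text \<open>
  Swapping the probabilities of two components \<open>j < i\<close> with \<open>q j \<le> q i\<close> does not decrease the
  reliability: conditioned on all other components, the two reliabilities differ by \<open>q i - q j\<close>
  times the difference between the probabilities that the system works with only \<open>j\<close>, respectively
  only \<open>i\<close>, of the two working, and this difference is nonnegative by strong stability.
  Among the maximising permutations take one minimising \<open>\<Sum>k. k * p (\<tau> k)\<close>; an ascent could be
  swapped to lower this sum, so the permuted vector is non-increasing. A non-increasing
  rearrangement is unique.
\<close>

lemma prob_bind_bernoulli_pmf:
  assumes "a \<in> {0..1}"
  shows "measure_pmf.prob (bernoulli_pmf a \<bind> f) X =
    a * measure_pmf.prob (f True) X + (1 - a) * measure_pmf.prob (f False) X"
proof -
  have "ennreal (measure_pmf.prob (bernoulli_pmf a \<bind> f) X) =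
    emeasure (measure_pmf (bernoulli_pmf a \<bind> f)) X"
    by (rule measure_pmf.emeasure_eq_measure[symmetric])
  also have "\<dots> = ennreal (a * measure_pmf.prob (f True) X + (1 - a) * measure_pmf.prob (f False) X)"
    using assms
    by (subst emeasure_bind_pmf)
      (simp add: measure_pmf.emeasure_eq_measure ennreal_mult ennreal_plus mult.commute)
  finally show ?thesis
    using assms by (subst (asm) ennreal_inj) auto
qed

text \<open>Pivotal decomposition: by independence the state of \<open>x\<close> can be drawn first,
  which splits the probability into the cases "\<open>x\<close> works" and "\<open>x\<close> has
  failed".\<close>

lemma prob_Pi_bernoulli_pmf_insert:
  assumes "finite A" "x \<notin> A" "q x \<in> {0..1}"
  shows "measure_pmf.prob (Pi_pmf (insert x A) d (\<lambda>k. bernoulli_pmf (q k))) {s. P s} =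
    q x * measure_pmf.prob (Pi_pmf A d (\<lambda>k. bernoulli_pmf (q k))) {s. P (s(x := True))} +
    (1 - q x) * measure_pmf.prob (Pi_pmf A d (\<lambda>k. bernoulli_pmf (q k))) {s. P (s(x := False))}"
proof -
  have "Pi_pmf (insert x A) d (\<lambda>k. bernoulli_pmf (q k)) =
    bernoulli_pmf (q x) \<bind> (\<lambda>y. map_pmf (\<lambda>s. s(x := y)) (Pi_pmf A d (\<lambda>k. bernoulli_pmf (q k))))"
    using assms(1,2) by (simp add: Pi_pmf_insert' map_pmf_def)
  then show ?thesis
    using assms(3) by (simp add: prob_bind_bernoulli_pmf vimage_def)
qed

lemma prob_Pi_bernoulli_pmf_swap_le:
  assumes "finite A" "i \<in> A" "j \<in> A" "i \<noteq> j" "q i \<in> {0..1}" "q j \<in> {0..1}" "q j \<le> q i"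
    and swap: "\<And>s. P (s(i := True, j := False)) \<Longrightarrow> P (s(i := False, j := True))"
  shows "measure_pmf.prob (Pi_pmf A d (\<lambda>k. bernoulli_pmf (q k))) {s. P s} \<le>
    measure_pmf.prob (Pi_pmf A d (\<lambda>k. bernoulli_pmf ((q \<circ> Transposition.transpose i j) k))) {s. P s}"
proof -
  define B where "B = A - {i, j}"
  have A: "A = insert j (insert i B)" and B: "finite B" "i \<notin> B" "j \<notin> insert i B"
    using assms(1-4) by (auto simp: B_def)
  \<comment> \<open>\<open>w a b\<close> is the conditional probability of \<open>P\<close> given
    state \<open>a\<close> of \<open>i\<close> and \<open>b\<close> of \<open>j\<close>; only the
    components in \<open>B\<close> remain random. \<open>R a b\<close> averages it when
    \<open>i\<close> and \<open>j\<close> work with probabilities \<open>a\<close> and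
    \<open>b\<close>.\<close>
  define w where "w a b = measure_pmf.prob (Pi_pmf B d (\<lambda>k. bernoulli_pmf (q k)))
    {s. P (s(i := a, j := b))}" for a b
  define R where "R a b = b * (a * w True True + (1 - a) * w False True) +
    (1 - b) * (a * w True False + (1 - a) * w False False)" for a b
  \<comment> \<open>Stated for every \<open>r\<close> agreeing with \<open>q\<close> on
    \<open>B\<close>, so that one formula serves both \<open>q\<close> and its transposed version;
    the swap then merely exchanges the arguments of \<open>R\<close>.\<close>
  have R: "measure_pmf.prob (Pi_pmf A d (\<lambda>k. bernoulli_pmf (r k))) {s. P s} = R (r i) (r j)"
    if "r i \<in> {0..1}" "r j \<in> {0..1}" "\<And>k. k \<in> B \<Longrightarrow> r k = q k" for r
  proof -
    have "Pi_pmf B d (\<lambda>k. bernoulli_pmf (r k)) = Pi_pmf B d (\<lambda>k. bernoulli_pmf (q k))"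
      using that(3) by (intro Pi_pmf_cong) auto
    then show ?thesis
      using that B by (simp add: A prob_Pi_bernoulli_pmf_insert R_def w_def)
  qed
  have "w True False \<le> w False True"
    unfolding w_def by (intro measure_pmf.finite_measure_mono) (auto intro: swap)
  then have "0 \<le> (q i - q j) * (w False True - w True False)"
    using assms(7) by simp
  \<comment> \<open>The terms in \<open>w True True\<close> and \<open>w False False\<close> are
    symmetric in the two arguments of \<open>R\<close> and cancel.\<close>
  also have "\<dots> = R (q j) (q i) - R (q i) (q j)"
    by (simp add: R_def algebra_simps)
  finally have "R (q i) (q j) \<le> R (q j) (q i)" by simp
  moreover have "(q \<circ> Transposition.transpose i j) k = q k" if "k \<in> B" for k
    using that by (auto simp: B_def Transposition.transpose_def)
  ultimately show ?thesis
    using R[of q] R[of "q \<circ> Transposition.transpose i j"] assms(5,6) by simp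
qed

lemma reliability_swap_le:
  assumes "strongly_stable n \<Phi>" "i \<in> {1..n}" "j \<in> {1..n}" "j < i"
    and "q i \<in> {0..1}" "q j \<in> {0..1}" "q j \<le> q i"
  shows "reliability n \<Phi> q \<le> reliability n \<Phi> (q \<circ> Transposition.transpose i j)"
  unfolding reliability_def
proof (rule prob_Pi_bernoulli_pmf_swap_le)
  fix s assume "is_path n \<Phi> (s(i := True, j := False))"
  \<comment> \<open>Whatever \<open>s\<close> is, the updated tuple has \<open>i\<close> working and
    \<open>j\<close> failed, as strong stability requires; its exchange overwrites both
    updates.\<close>
  then have "is_path n \<Phi> ((s(i := True, j := False))(i := False, j := True))"
    using assms(1-4) unfolding strongly_stable_def by (metis fun_upd_apply less_irrefl)
  moreover have "s(i := True, j := False, i := False, j := True) = s(i := False, j := True)"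
    by auto
  ultimately show "is_path n \<Phi> (s(i := False, j := True))" by simp
qed (use assms in auto)

lemma reliability_cong:
  assumes "\<And>k. k \<in> {1..n} \<Longrightarrow> q k = r k"
  shows "reliability n \<Phi> q = reliability n \<Phi> r"
proof -
  have "Pi_pmf {1..n} False (\<lambda>k. bernoulli_pmf (q k)) =
    Pi_pmf {1..n} False (\<lambda>k. bernoulli_pmf (r k))"
    using assms by (intro Pi_pmf_cong) auto
  then show ?thesis by (simp add: reliability_def)
qed

text \<open>A sorted list is determined by its multiset of entries, and both permutations list the
  same multiset. If \<open>p\<close> has ties, \<sigma> and \<tau> may differ, so only the values
  are compared.\<close>

lemma antimono_rearrangement_unique:
  fixes p :: "nat \<Rightarrow> real"
  assumes "\<sigma> permutes {1..n}" "\<tau> permutes {1..n}"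
    and "antimono_on {1..n} (p \<circ> \<sigma>)" "antimono_on {1..n} (p \<circ> \<tau>)"
    and "k \<in> {1..n}"
  shows "(p \<circ> \<sigma>) k = (p \<circ> \<tau>) k"
proof -
  \<comment> \<open>The sign turns non-increasing into the ascending order of
    \<open>sorted\<close>.\<close>
  define L where "L \<rho> = map (\<lambda>k. - p (\<rho> k)) [1..<Suc n]" for \<rho> :: "nat \<Rightarrow> nat"
  have sorted: "sorted (L \<rho>)" if "antimono_on {1..n} (p \<circ> \<rho>)" for \<rho>
    unfolding L_def sorted_wrt_map
    by (rule sorted_wrt_mono_rel[OF _ sorted_upt])
      (use that in \<open>auto simp: monotone_on_def\<close>)
  have mset: "mset (L \<rho>) = image_mset (\<lambda>k. - p k) (mset_set {1..n})" if "\<rho> permutes {1..n}" for \<rho>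
  proof -
    have "mset (L \<rho>) = image_mset (\<lambda>k. - p k) (image_mset \<rho> (mset_set {1..n}))"
      by (simp add: L_def multiset.map_comp o_def atLeastLessThanSuc_atLeastAtMost del: upt_Suc)
    also have "image_mset \<rho> (mset_set {1..n}) = mset_set {1..n}"
      using that by (rule permutes_image_mset)
    finally show ?thesis .
  qed
  have "L \<sigma> = L \<tau>"
    using assms sorted mset by (metis properties_for_sort)
  then have "\<forall>k\<in>{1..n}. p (\<sigma> k) = p (\<tau> k)"
    by (auto simp: L_def simp del: upt_Suc)
  then show ?thesis using assms(5) by simp
qed

text \<open>Moving the larger value to the smaller index lowers the sum by exactly
  \<open>(i - j) * (q i - q j)\<close>.\<close>

lemma weighted_sum_swap_less:
  fixes q :: "nat \<Rightarrow> real"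
  assumes "finite A" "i \<in> A" "j \<in> A" "j < i" "q j < q i"
  shows "(\<Sum>k\<in>A. real k * (q \<circ> Transposition.transpose i j) k) < (\<Sum>k\<in>A. real k * q k)"
proof -
  define B where "B = A - {i, j}"
  have A: "A = insert i (insert j B)" and B: "finite B" "i \<notin> B" "j \<notin> B"
    using assms by (auto simp: B_def)
  have split: "(\<Sum>k\<in>A. f k) = f i + f j + (\<Sum>k\<in>B. f k)" for f :: "nat \<Rightarrow> real"
    using A B assms(4) by simp
  have "(\<Sum>k\<in>B. real k * (q \<circ> Transposition.transpose i j) k) = (\<Sum>k\<in>B. real k * q k)"
    using B by (intro sum.cong) (auto simp: Transposition.transpose_def)
  moreover have "0 < (real i - real j) * (q i - q j)"
    using assms(4,5) by simp
  ultimately show ?thesis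
    by (simp add: split algebra_simps)
qed

theorem corollary3p5:
  fixes n :: nat and \<Phi> :: "(nat \<Rightarrow> bool) \<Rightarrow> bool" and p :: "nat \<Rightarrow> real" and \<sigma> :: "nat \<Rightarrow> nat"
  assumes "coherent_system n \<Phi>"
    and "strongly_stable n \<Phi>"
    and "\<forall>k\<in>{1..n}. p k \<in> {0..1}"
    and "\<sigma> permutes {1..n}"
    and "antimono_on {1..n} (p \<circ> \<sigma>)"
  shows "reliability n \<Phi> (p \<circ> \<sigma>) =
         Max ((\<lambda>\<tau>. reliability n \<Phi> (p \<circ> \<tau>)) ` {\<tau>. \<tau> permutes {1..n}})"
proof -
  define S where "S = {\<tau>::nat \<Rightarrow> nat. \<tau> permutes {1..n}}"
  define R where "R \<tau> = reliability n \<Phi> (p \<circ> \<tau>)" for \<tau>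
  define W where "W \<tau> = (\<Sum>k\<in>{1..n}. real k * (p \<circ> \<tau>) k)" for \<tau>
  have S: "finite S" "\<sigma> \<in> S"
    using assms(4) by (auto simp: S_def finite_permutations)
  define M where "M = {\<tau> \<in> S. R \<tau> = Max (R ` S)}"
  have "Max (R ` S) \<in> R ` S"
    using S by (intro Max_in) auto
  then have "finite M" "M \<noteq> {}"
    using S(1) by (auto simp: M_def)
  then obtain \<tau> where \<tau>: "\<tau> \<in> M" and min: "\<And>\<rho>. \<rho> \<in> M \<Longrightarrow> W \<tau> \<le> W \<rho>"
    by (meson arg_min_if_finite(1) arg_min_least)
  have perm: "\<tau> permutes {1..n}"
    using \<tau> by (simp add: M_def S_def)
  have "antimono_on {1..n} (p \<circ> \<tau>)"
  proof (rule ccontr)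
    assume "\<not> antimono_on {1..n} (p \<circ> \<tau>)"
    then obtain j i where ij: "j \<in> {1..n}" "i \<in> {1..n}" "j \<le> i" "(p \<circ> \<tau>) j < (p \<circ> \<tau>) i"
      by (auto simp: monotone_on_def not_le)
    then have "j < i"
      by (cases "j = i") auto
    define \<rho> where "\<rho> = \<tau> \<circ> Transposition.transpose i j"
    have \<rho>: "p \<circ> \<rho> = (p \<circ> \<tau>) \<circ> Transposition.transpose i j"
      by (simp add: \<rho>_def o_assoc)
    have "\<rho> \<in> S"
      using ij perm by (simp add: S_def \<rho>_def permutes_compose permutes_swap_id)
    have "\<tau> k \<in> {1..n}" if "k \<in> {1..n}" for k
      using that permutes_in_image[OF perm] by blast
    then have "(p \<circ> \<tau>) k \<in> {0..1}" if "k \<in> {1..n}" for k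
      using that assms(3) by simp
    then have "R \<tau> \<le> R \<rho>"
      unfolding R_def \<rho> using ij \<open>j < i\<close> assms(2) by (intro reliability_swap_le) auto
    moreover have "R \<rho> \<le> Max (R ` S)"
      using S(1) \<open>\<rho> \<in> S\<close> by simp
    \<comment> \<open>\<open>R \<tau>\<close> is already the maximum, so the swap cannot raise it:
      \<rho> is again a maximiser, but with smaller weight \<open>W\<close>, against the choice of
      \<tau>.\<close>
    ultimately have "\<rho> \<in> M"
      using \<tau> \<open>\<rho> \<in> S\<close> by (simp add: M_def)
    moreover have "W \<rho> < W \<tau>"
      unfolding W_def \<rho> using ij \<open>j < i\<close> by (intro weighted_sum_swap_less) auto
    ultimately show False
      using min by fastforce
  qed
  then have "R \<sigma> = R \<tau>"
    unfolding R_def using assms(4,5) perm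
    by (intro reliability_cong antimono_rearrangement_unique)
  also have "\<dots> = Max (R ` S)"
    using \<tau> by (simp add: M_def)
  finally show ?thesis
    by (simp add: R_def S_def)
qed

end
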